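(* Let $\mathcal{T}$ be a TBox, let $\Sigma\subseteq\mathrm{sig}(\mathcal{T})$ be a signature, and let $\chi_{\mathsf f}=\langle\theta^{\mathsf f},\mathcal{A}_0^{\mathsf f},\mathcal{A}_r^{\mathsf f}\rangle$ be the module setting for $\mathcal{T}$ and $\Sigma$ defined in the context. Then $\mathcal{M}^{\chi_{\mathsf f}}\equiv^{\mathsf f}_\Sigma\mathcal{T}$, i.e. $\mathcal{M}^{\chi_{\mathsf f}}$ is $\Sigma$-fact inseparable from $\mathcal{T}$: for every fact $\gamma$ and ABox $\mathcal{A}$ over $\Sigma$, $\mathcal{M}^{\chi_{\mathsf f}}\cup\mathcal{A}\models\gamma$ if and only if $\mathcal{T}\cup\mathcal{A}\models\gamma$.
   Context: Rules and TBoxes. Standard first-order logic is used. A signature is a set of predicates; $\mathrm{sig}(F)$ is the signature of a set of formulas $F$; the nullary falsehood predicate $\bot$ is assumed to belong to every signature. A rule is a function-free sentence $\forall\mathbf{x}.[\varphi(\mathbf{x})\to\exists\mathbf{y}.[\bigvee_{i=1}^n\psi_i(\mathbf{x},\mathbf{y})]]$ with the body $\varphi$ and the $\psi_i$ conjunctions of distinct atoms ($n\ge 0$; for $n=0$ the head is the empty disjunction, i.e. $\bot$). Rules are safe (all universally quantified variables in the head occur in the body), and w.l.o.g. the truth symbol $\top$ does not occur in rule heads and $\bot$ does not occur in rule bodies. Universal quantifiers are usually omitted. A TBox is a finite set of rules; TBoxes mentioning equality are extended with its standard axiomatisation. A fact is a function-free ground atom; an ABox is a finite set of facts; a $\Sigma$-ABox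 is an ABox over the predicates of $\Sigma$. Standing assumptions: $\mathcal{T}$ contains no constants and rules in $\mathcal{T}$ do not share existentially quantified variables. Datalog. A rule is datalog if its head has at most one atom and all variables are universally quantified; a datalog program $\mathcal{P}$ is a set of datalog rules. A fact $\gamma$ is a consequence of a datalog rule $\bigwedge_{i=1}^n\gamma_i'\to\delta$ and facts $\gamma_1,\dots,\gamma_n$ if $\gamma=\delta\sigma$ with $\sigma$ a most general unifier of $\gamma_i,\gamma_i'$ for each $1\le i\le n$. A proof of $\gamma$ in $\mathcal{P}\cup\mathcal{A}$ ($\mathcal{A}$ an ABox) is a pair $(T,\lambda)$ with $T$ a tree and $\lambda$ mapping nodes of $T$ to facts and edges of $T$ to rules of $\mathcal{P}$, such that for each node $v$: (1) $\lambda(v)=\gamma$ if $v$ is the root; (2) $\lambda(v)\in\mathcal{A}$ if $v$ is a leaf; (3) if $v$ has children $w_1,\dots,w_n$, then all edges from $v$ to the $w_i$ are labelled by the same rule $r$ and $\lambda(v)$ is a consequence of $r$ and $\lambda(w_1),\dots,\lambda(w_n)$. The support of $\gamma$ is the set of rules occurring in some proof of $\gamma$ in $\mathcal{P}\cup\mathcal{A}$. Module settings. A module setting for $\mathcal{T}$ and $\Sigma$ is a tuple $\chi=\langle\theta,\mathcal{A}_0,\mathcal{A}_r\rangle$ with $\theta$ a substitution from the existentially quantified variables of $\mathcal{T}$ to constants, $\mathcal{A}_0$ a $\Sigma$-ABox, $\mathcal{A}_r$ a $\mathrm{sig}(\mathcal{T})$-ABox, and such that no constant in $\chi$ occurs in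 $\mathcal{T}$. The program $\mathcal{P}^\chi$ is the smallest datalog program containing, for each rule $\varphi(\mathbf{x})\to\exists\mathbf{y}.[\bigvee_{i=1}^n\psi_i(\mathbf{x},\mathbf{y})]$ in $\mathcal{T}$, the following corresponding datalog rules: $\varphi\to\bot$ if $n=0$, and $\varphi\to\gamma\theta$ for each $1\le i\le n$ and each atom $\gamma$ in $\psi_i$. The support of $\chi$ is the set of rules of $\mathcal{P}^\chi$ that support a fact from $\mathcal{A}_r$ in $\mathcal{P}^\chi\cup\mathcal{A}_0$. The module $\mathcal{M}^\chi$ is the set of rules in $\mathcal{T}$ that have a corresponding datalog rule in the support of $\chi$. The setting $\chi_{\mathsf f}$. Let $c_y$ (for each existentially quantified variable $y$ in $\mathcal{T}$) and $\ast$ be fresh constants. Then $\theta^{\mathsf f}=\{y\mapsto c_y\mid y\text{ existentially quantified in }\mathcal{T}\}$, $\mathcal{A}_0^{\mathsf f}=\{A(\ast,\dots,\ast)\mid A\in\Sigma\}$ and $\mathcal{A}_r^{\mathsf f}=\mathcal{A}_0^{\mathsf f}$. *)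

theory Defs
  imports Main "HOL-Library.Infinite_Typeclass"
begin

section \<open>Syntax\<close>

text \<open>
  A predicate symbol carries its arity. \<open>Bot\<close> is the nullary falsehood predicate.
  Equality is not a logical symbol: a TBox that mentions it is understood to contain its
  axiomatisation, so that equality is one of the symbols \<open>Pred p 2\<close>.
\<close>

datatype 'p predicate = Bot | Pred 'p nat

primrec arity :: "'p predicate \<Rightarrow> nat" where
  "arity Bot = 0"
| "arity (Pred p n) = n"

datatype ('v, 'c) trm = Var 'v | Const 'c

datatype (dead 'p, 't) atom = Atom (pred_of: "'p predicate") (args: "'t list")

type_synonym ('p, 'v, 'c) tatom = "('p, ('v, 'c) trm) atom"
type_synonym ('p, 'c) fact = "('p, 'c) atom"

definition wf_atom :: "('p, 't) atom \<Rightarrow> bool" where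
  "wf_atom a \<longleftrightarrow> length (args a) = arity (pred_of a)"

definition atom_vars :: "('p, 'v, 'c) tatom \<Rightarrow> 'v set" where
  "atom_vars a = {x. Var x \<in> set (args a)}"

definition atom_constants :: "('p, 'v, 'c) tatom \<Rightarrow> 'c set" where
  "atom_constants a = {k. Const k \<in> set (args a)}"

text \<open>
  \<open>Rule \<phi> ys [\<psi>\<^sub>1, \<dots>, \<psi>\<^sub>n]\<close> stands for the sentence
  \<open>\<forall>xs. \<phi> \<longrightarrow> (\<exists>ys. \<psi>\<^sub>1 \<or> \<dots> \<or> \<psi>\<^sub>n)\<close>, where \<open>xs\<close> are all variables other than \<open>ys\<close>.
  Conjunctions are lists of atoms; the empty conjunction is the truth symbol.
\<close>

datatype ('p, 'v, 'c) rule =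
  Rule (body: "('p, 'v, 'c) tatom list") (exs: "'v list") (heads: "('p, 'v, 'c) tatom list list")

definition body_atoms :: "('p, 'v, 'c) rule \<Rightarrow> ('p, 'v, 'c) tatom set" where
  "body_atoms r = set (body r)"

definition head_atoms :: "('p, 'v, 'c) rule \<Rightarrow> ('p, 'v, 'c) tatom set" where
  "head_atoms r = (\<Union>\<psi>\<in>set (heads r). set \<psi>)"

definition safe :: "('p, 'v, 'c) rule \<Rightarrow> bool" where
  "safe r \<longleftrightarrow> (\<Union>a\<in>head_atoms r. atom_vars a) - set (exs r) \<subseteq> (\<Union>a\<in>body_atoms r. atom_vars a)"

text \<open>The condition \<open>[] \<notin> set (heads r)\<close> says that the truth symbol does not occur in the head.\<close>

definition wf_rule :: "('p, 'v, 'c) rule \<Rightarrow> bool" where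
  "wf_rule r \<longleftrightarrow>
     (\<forall>a\<in>body_atoms r \<union> head_atoms r. wf_atom a) \<and>
     distinct (body r) \<and> (\<forall>\<psi>\<in>set (heads r). distinct \<psi>) \<and>
     distinct (exs r) \<and> set (exs r) \<inter> (\<Union>a\<in>body_atoms r. atom_vars a) = {} \<and>
     safe r \<and>
     Bot \<notin> pred_of ` body_atoms r \<and> [] \<notin> set (heads r)"

definition tbox :: "('p, 'v, 'c) rule set \<Rightarrow> bool" where
  "tbox T \<longleftrightarrow> finite T \<and> (\<forall>r\<in>T. wf_rule r)"

definition tbox_sig :: "('p, 'v, 'c) rule set \<Rightarrow> 'p predicate set" where
  "tbox_sig T = insert Bot (\<Union>r\<in>T. pred_of ` (body_atoms r \<union> head_atoms r))"

definition tbox_constants :: "('p, 'v, 'c) rule set \<Rightarrow> 'c set" where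
  "tbox_constants T = (\<Union>r\<in>T. \<Union>a\<in>body_atoms r \<union> head_atoms r. atom_constants a)"

definition tbox_exs :: "('p, 'v, 'c) rule set \<Rightarrow> 'v set" where
  "tbox_exs T = (\<Union>r\<in>T. set (exs r))"

definition exs_apart :: "('p, 'v, 'c) rule set \<Rightarrow> bool" where
  "exs_apart T \<longleftrightarrow> (\<forall>r\<in>T. \<forall>s\<in>T. r \<noteq> s \<longrightarrow> set (exs r) \<inter> set (exs s) = {})"

definition signature :: "'p predicate set \<Rightarrow> bool" where
  "signature \<Sigma> \<longleftrightarrow> Bot \<in> \<Sigma>"

definition fact_over :: "'p predicate set \<Rightarrow> ('p, 'c) fact \<Rightarrow> bool" where
  "fact_over \<Sigma> \<gamma> \<longleftrightarrow> wf_atom \<gamma> \<and> pred_of \<gamma> \<in> \<Sigma>"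

definition abox_over :: "'p predicate set \<Rightarrow> ('p, 'c) fact set \<Rightarrow> bool" where
  "abox_over \<Sigma> A \<longleftrightarrow> finite A \<and> (\<forall>\<alpha>\<in>A. fact_over \<Sigma> \<alpha>)"


section \<open>First-order semantics\<close>

record ('p, 'c, 'd) interp =
  dom_of :: "'d set"
  const_int :: "'c \<Rightarrow> 'd"
  pred_int :: "'p predicate \<Rightarrow> 'd list set"

definition is_interp :: "('p, 'c, 'd) interp \<Rightarrow> bool" where
  "is_interp I \<longleftrightarrow>
     dom_of I \<noteq> {} \<and> range (const_int I) \<subseteq> dom_of I \<and>
     (\<forall>P. pred_int I P \<subseteq> {ds. set ds \<subseteq> dom_of I \<and> length ds = arity P}) \<and>
     pred_int I Bot = {}"

primrec trm_val :: "('p, 'c, 'd) interp \<Rightarrow> ('v \<Rightarrow> 'd) \<Rightarrow> ('v, 'c) trm \<Rightarrow> 'd" where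
  "trm_val I v (Var x) = v x"
| "trm_val I v (Const k) = const_int I k"

definition sat_atom :: "('p, 'c, 'd) interp \<Rightarrow> ('v \<Rightarrow> 'd) \<Rightarrow> ('p, 'v, 'c) tatom \<Rightarrow> bool" where
  "sat_atom I v a \<longleftrightarrow> map (trm_val I v) (args a) \<in> pred_int I (pred_of a)"

definition sat_fact :: "('p, 'c, 'd) interp \<Rightarrow> ('p, 'c) fact \<Rightarrow> bool" where
  "sat_fact I \<gamma> \<longleftrightarrow> map (const_int I) (args \<gamma>) \<in> pred_int I (pred_of \<gamma>)"

definition sat_rule :: "('p, 'c, 'd) interp \<Rightarrow> ('p, 'v, 'c) rule \<Rightarrow> bool" where
  "sat_rule I r \<longleftrightarrow>
     (\<forall>v. range v \<subseteq> dom_of I \<and> (\<forall>a\<in>set (body r). sat_atom I v a) \<longrightarrow>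
       (\<exists>w. range w \<subseteq> dom_of I \<and> (\<forall>x. x \<notin> set (exs r) \<longrightarrow> w x = v x) \<and>
         (\<exists>\<psi>\<in>set (heads r). \<forall>a\<in>set \<psi>. sat_atom I w a)))"

text \<open>
  A definition cannot quantify over types, so the type \<open>'d\<close> from which the domains of
  interpretations are drawn is a parameter. The domains are all nonempty subsets of \<open>'d\<close>.
  As \<open>'d\<close> is infinite, for finite \<open>T\<close> and \<open>A\<close> every choice of \<open>'d\<close> yields the usual
  entailment \<open>T \<union> A \<Turnstile> \<gamma>\<close> over arbitrary domains, by the downward Loewenheim-Skolem theorem.
\<close>

definition entails ::
  "'d::infinite itself \<Rightarrow> ('p, 'v, 'c) rule set \<Rightarrow> ('p, 'c) fact set \<Rightarrow> ('p, 'c) fact \<Rightarrow> bool" where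
  "entails _ T A \<gamma> \<longleftrightarrow>
     (\<forall>I :: ('p, 'c, 'd) interp.
        is_interp I \<and> (\<forall>r\<in>T. sat_rule I r) \<and> (\<forall>\<alpha>\<in>A. sat_fact I \<alpha>) \<longrightarrow> sat_fact I \<gamma>)"

definition fact_inseparable ::
  "'d::infinite itself \<Rightarrow> 'p predicate set \<Rightarrow> ('p, 'v, 'c) rule set \<Rightarrow> ('p, 'v, 'c) rule set \<Rightarrow> bool"
  where
  "fact_inseparable D \<Sigma> T T' \<longleftrightarrow>
     (\<forall>\<gamma> A. fact_over \<Sigma> \<gamma> \<and> abox_over \<Sigma> A \<longrightarrow> (entails D T A \<gamma> \<longleftrightarrow> entails D T' A \<gamma>))"


section \<open>Datalog\<close>

datatype ('p, 'v, 'c) datalog_rule =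
  DRule (dbody: "('p, 'v, 'c) tatom list") (dhead: "('p, 'v, 'c) tatom")

type_synonym ('v, 'c) subst = "'v \<Rightarrow> ('v, 'c) trm"

primrec subst_trm :: "('v, 'c) subst \<Rightarrow> ('v, 'c) trm \<Rightarrow> ('v, 'c) trm" where
  "subst_trm \<sigma> (Var x) = \<sigma> x"
| "subst_trm \<sigma> (Const k) = Const k"

definition subst_atom :: "('v, 'c) subst \<Rightarrow> ('p, 'v, 'c) tatom \<Rightarrow> ('p, 'v, 'c) tatom" where
  "subst_atom \<sigma> = map_atom (subst_trm \<sigma>)"

definition fact_atom :: "('p, 'c) fact \<Rightarrow> ('p, 'v, 'c) tatom" where
  "fact_atom = map_atom Const"

definition unifier :: "('v, 'c) subst \<Rightarrow> (('p, 'v, 'c) tatom \<times> ('p, 'v, 'c) tatom) set \<Rightarrow> bool" where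
  "unifier \<sigma> E \<longleftrightarrow> (\<forall>(a, b)\<in>E. subst_atom \<sigma> a = subst_atom \<sigma> b)"

definition is_mgu :: "('v, 'c) subst \<Rightarrow> (('p, 'v, 'c) tatom \<times> ('p, 'v, 'c) tatom) set \<Rightarrow> bool" where
  "is_mgu \<sigma> E \<longleftrightarrow>
     unifier \<sigma> E \<and> (\<forall>\<tau>. unifier \<tau> E \<longrightarrow> (\<exists>\<rho>. \<forall>x. \<tau> x = subst_trm \<rho> (\<sigma> x)))"

definition consequence ::
  "('p, 'c) fact \<Rightarrow> ('p, 'v, 'c) datalog_rule \<Rightarrow> ('p, 'c) fact list \<Rightarrow> bool" where
  "consequence \<gamma> d \<gamma>s \<longleftrightarrow>
     length \<gamma>s = length (dbody d) \<and>
     (\<exists>\<sigma>. is_mgu \<sigma> (set (zip (map fact_atom \<gamma>s) (dbody d))) \<and>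
          fact_atom \<gamma> = subst_atom \<sigma> (dhead d))"

text \<open>
  All edges from a node to its children carry the same rule, so that rule is stored at the
  node. An inner node has an empty list of children only if its rule has the
  truth symbol as its body; such a rule is applicable without any premises.
\<close>

datatype ('p, 'v, 'c) ptree =
    Leaf "('p, 'c) fact"
  | Node "('p, 'c) fact" "('p, 'v, 'c) datalog_rule" "('p, 'v, 'c) ptree list"

primrec root :: "('p, 'v, 'c) ptree \<Rightarrow> ('p, 'c) fact" where
  "root (Leaf \<gamma>) = \<gamma>"
| "root (Node \<gamma> d ts) = \<gamma>"

fun valid_tree ::
  "('p, 'v, 'c) datalog_rule set \<Rightarrow> ('p, 'c) fact set \<Rightarrow> ('p, 'v, 'c) ptree \<Rightarrow> bool" where
  "valid_tree P A (Leaf \<gamma>) \<longleftrightarrow> \<gamma> \<in> A"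
| "valid_tree P A (Node \<gamma> d ts) \<longleftrightarrow>
     d \<in> P \<and> consequence \<gamma> d (map root ts) \<and> (\<forall>t\<in>set ts. valid_tree P A t)"

fun tree_rules :: "('p, 'v, 'c) ptree \<Rightarrow> ('p, 'v, 'c) datalog_rule set" where
  "tree_rules (Leaf \<gamma>) = {}"
| "tree_rules (Node \<gamma> d ts) = insert d (\<Union>t\<in>set ts. tree_rules t)"

definition is_proof ::
  "('p, 'v, 'c) datalog_rule set \<Rightarrow> ('p, 'c) fact set \<Rightarrow> ('p, 'c) fact \<Rightarrow> ('p, 'v, 'c) ptree \<Rightarrow> bool"
  where
  "is_proof P A \<gamma> t \<longleftrightarrow> root t = \<gamma> \<and> valid_tree P A t"

definition fact_support ::
  "('p, 'v, 'c) datalog_rule set \<Rightarrow> ('p, 'c) fact set \<Rightarrow> ('p, 'c) fact \<Rightarrow> ('p, 'v, 'c) datalog_rule set"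
  where
  "fact_support P A \<gamma> = (\<Union>t\<in>{t. is_proof P A \<gamma> t}. tree_rules t)"


section \<open>Module settings\<close>

record ('p, 'v, 'c) setting =
  theta :: "'v \<rightharpoonup> 'c"
  abox0 :: "('p, 'c) fact set"
  aboxr :: "('p, 'c) fact set"

definition setting_constants :: "('p, 'v, 'c) setting \<Rightarrow> 'c set" where
  "setting_constants \<chi> = ran (theta \<chi>) \<union> (\<Union>\<alpha>\<in>abox0 \<chi> \<union> aboxr \<chi>. set (args \<alpha>))"

definition module_setting ::
  "('p, 'v, 'c) rule set \<Rightarrow> 'p predicate set \<Rightarrow> ('p, 'v, 'c) setting \<Rightarrow> bool" where
  "module_setting T \<Sigma> \<chi> \<longleftrightarrow>
     dom (theta \<chi>) = tbox_exs T \<and> abox_over \<Sigma> (abox0 \<chi>) \<and> abox_over (tbox_sig T) (aboxr \<chi>) \<and>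
     setting_constants \<chi> \<inter> tbox_constants T = {}"

text \<open>
  In the datalog rules of \<open>r\<close>, the substitution only acts on the existentially quantified
  variables of \<open>r\<close> itself. This matters if a variable that is universally quantified in \<open>r\<close>
  is existentially quantified in another rule.
\<close>

definition skolem :: "('v \<rightharpoonup> 'c) \<Rightarrow> ('p, 'v, 'c) rule \<Rightarrow> ('v, 'c) subst" where
  "skolem \<theta> r x =
     (if x \<in> set (exs r) then (case \<theta> x of Some k \<Rightarrow> Const k | None \<Rightarrow> Var x) else Var x)"

definition datalog_rules ::
  "('v \<rightharpoonup> 'c) \<Rightarrow> ('p, 'v, 'c) rule \<Rightarrow> ('p, 'v, 'c) datalog_rule set" where
  "datalog_rules \<theta> r =
     (if heads r = [] then {DRule (body r) (Atom Bot [])}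
      else {DRule (body r) (subst_atom (skolem \<theta> r) a) | a. a \<in> head_atoms r})"

definition setting_program ::
  "('p, 'v, 'c) rule set \<Rightarrow> ('p, 'v, 'c) setting \<Rightarrow> ('p, 'v, 'c) datalog_rule set" where
  "setting_program T \<chi> = (\<Union>r\<in>T. datalog_rules (theta \<chi>) r)"

definition setting_support ::
  "('p, 'v, 'c) rule set \<Rightarrow> ('p, 'v, 'c) setting \<Rightarrow> ('p, 'v, 'c) datalog_rule set" where
  "setting_support T \<chi> = (\<Union>\<gamma>\<in>aboxr \<chi>. fact_support (setting_program T \<chi>) (abox0 \<chi>) \<gamma>)"

definition setting_module ::
  "('p, 'v, 'c) rule set \<Rightarrow> ('p, 'v, 'c) setting \<Rightarrow> ('p, 'v, 'c) rule set" where
  "setting_module T \<chi> = {r\<in>T. datalog_rules (theta \<chi>) r \<inter> setting_support T \<chi> \<noteq> {}}"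

definition fresh_constants :: "('p, 'v, 'c) rule set \<Rightarrow> ('v \<Rightarrow> 'c) \<Rightarrow> 'c \<Rightarrow> bool" where
  "fresh_constants T c star \<longleftrightarrow>
     inj_on c (tbox_exs T) \<and> star \<notin> c ` tbox_exs T \<and>
     insert star (c ` tbox_exs T) \<inter> tbox_constants T = {}"

definition fact_setting ::
  "('p, 'v, 'c) rule set \<Rightarrow> 'p predicate set \<Rightarrow> ('v \<Rightarrow> 'c) \<Rightarrow> 'c \<Rightarrow> ('p, 'v, 'c) setting" where
  "fact_setting T \<Sigma> c star =
     \<lparr>theta = (\<lambda>y. if y \<in> tbox_exs T then Some (c y) else None),
      abox0 = {Atom P (replicate (arity P) star) | P. P \<in> \<Sigma>},
      aboxr = {Atom P (replicate (arity P) star) | P. P \<in> \<Sigma>}\<rparr>"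

lemma finite_tbox_sig:
  assumes "tbox T"
  shows "finite (tbox_sig T)"
  using assms by (auto simp: tbox_def tbox_sig_def body_atoms_def head_atoms_def)

lemma module_setting_fact_setting:
  assumes "tbox T" "\<Sigma> \<subseteq> tbox_sig T" "fresh_constants T c star"
  shows "module_setting T \<Sigma> (fact_setting T \<Sigma> c star)"
proof -
  let ?A = "{Atom P (replicate (arity P) star) | P. P \<in> \<Sigma>}"
  have "finite \<Sigma>"
    using assms finite_tbox_sig finite_subset by blast
  then have "finite ?A" by simp
  then have A: "abox_over \<Sigma> ?A" "abox_over (tbox_sig T) ?A"
    using assms(2) by (auto simp: abox_over_def fact_over_def wf_atom_def)
  have "setting_constants (fact_setting T \<Sigma> c star) \<subseteq> insert star (c ` tbox_exs T)"
    by (auto simp: setting_constants_def fact_setting_def ran_def split: if_splits)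
  then have "setting_constants (fact_setting T \<Sigma> c star) \<inter> tbox_constants T = {}"
    using assms(3) unfolding fresh_constants_def by blast
  with A show ?thesis
    by (auto simp: module_setting_def fact_setting_def dom_def)
qed

end

theory Submission
  imports Defs
begin

text \<open>
  Let \<open>M\<close> be the module. A model \<open>I\<close> of \<open>M\<close> and \<open>A\<close> that refutes \<open>\<gamma>\<close> is turned into such a model
  of \<open>T\<close> and \<open>A\<close>. Its domain is the product of the domain of \<open>I\<close> with the finite set of labels
  consisting of \<open>star\<close> and the constants \<open>c y\<close>; constants are interpreted with label \<open>star\<close>.
  A predicate holds of a tuple if the fact on the labels is provable in the datalog program and,
  in case all rules in its proofs are in the support of the setting, the predicate also holds in
  \<open>I\<close> of the first components. On tuples with label \<open>star\<close> nothing changes for predicates in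
  \<open>\<Sigma>\<close>. If the body of a rule of \<open>T\<close> holds, all its head atoms are provable on the labels once each
  \<open>y\<close> receives the label \<open>c y\<close>. Either the proofs of none of them stay within the support, and
  any disjunct is then true, or those of some head atom do; then the rule is in \<open>M\<close>, the proofs
  of the body facts stay within the support as well, and \<open>I\<close> provides the disjunct.
\<close>

section \<open>Grounding of atoms and most general unifiers\<close>

definition ground :: "('v \<Rightarrow> 'c) \<Rightarrow> ('p, 'v, 'c) tatom \<Rightarrow> ('p, 'c) fact" where
  "ground l = map_atom (case_trm l id)"

lemma pred_of_ground [simp]: "pred_of (ground l a) = pred_of a"
  by (cases a) (simp add: ground_def)

lemma args_ground: "args (ground l a) = map (case_trm l id) (args a)"
  by (cases a) (simp add: ground_def)

lemma subst_atom_fact_atom [simp]: "subst_atom \<sigma> (fact_atom \<gamma>) = fact_atom \<gamma>"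
  by (cases \<gamma>) (simp add: subst_atom_def fact_atom_def)

lemma subst_atom_eq_fact_atom_ground_iff:
  "subst_atom \<sigma> a = fact_atom (ground l a) \<longleftrightarrow> (\<forall>x\<in>atom_vars a. \<sigma> x = Const (l x))"
proof -
  have "subst_trm \<sigma> t = Const (case_trm l id t) \<longleftrightarrow> (\<forall>x. t = Var x \<longrightarrow> \<sigma> x = Const (l x))" for t
    by (cases t) auto
  then show ?thesis
    by (cases a) (auto simp: ground_def subst_atom_def fact_atom_def atom_vars_def)
qed

text \<open>The unifiers of the body with its grounding are exactly the substitutions sending each
  body variable \<open>x\<close> to \<open>Const (l x)\<close>. The one fixing all other variables
  is most general, and the assumption makes it ground the head as well.\<close>

lemma consequence_ground:
  fixes a :: "('p, 'v, 'c) tatom"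
  assumes "atom_vars a \<subseteq> (\<Union>b\<in>set bs. atom_vars b)"
  shows "consequence (ground l a) (DRule bs a) (map (ground l) bs)"
proof -
  let ?E = "set (zip (map fact_atom (map (ground l) bs)) bs)"
  let ?X = "\<Union>b\<in>set bs. atom_vars b"
  let ?\<sigma> = "\<lambda>x. if x \<in> ?X then Const (l x) else Var x"
  have E: "?E = (\<lambda>b. (fact_atom (ground l b), b)) ` set bs"
    by (simp add: zip_map1 zip_same_conv_map)
  have unif: "unifier \<tau> ?E \<longleftrightarrow> (\<forall>x\<in>?X. \<tau> x = Const (l x))" for \<tau>
    unfolding unifier_def E
    by (simp add: subst_atom_eq_fact_atom_ground_iff eq_commute[of "fact_atom _" "subst_atom _ _"])
  have "is_mgu ?\<sigma> ?E"
    unfolding is_mgu_def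
  proof (intro conjI allI impI)
    show "unifier ?\<sigma> ?E" unfolding unif by simp
    fix \<tau> :: "('v, 'c) subst"
    assume "unifier \<tau> ?E"
    then have "\<tau> x = subst_trm \<tau> (?\<sigma> x)" for x
      unfolding unif by auto
    then show "\<exists>\<rho>. \<forall>x. \<tau> x = subst_trm \<rho> (?\<sigma> x)" by blast
  qed
  moreover have "subst_atom ?\<sigma> a = fact_atom (ground l a)"
    using assms by (auto simp: subst_atom_eq_fact_atom_ground_iff)
  ultimately show ?thesis
    by (auto simp: consequence_def)
qed

section \<open>Datalog provability and support\<close>

definition provable ::
  "('p, 'v, 'c) datalog_rule set \<Rightarrow> ('p, 'c) fact set \<Rightarrow> ('p, 'c) fact \<Rightarrow> bool" where
  "provable P A \<gamma> \<longleftrightarrow> (\<exists>t. is_proof P A \<gamma> t)"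

lemma provable_fact: "\<gamma> \<in> A \<Longrightarrow> provable P A \<gamma>"
  unfolding provable_def is_proof_def by (rule exI[of _ "Leaf \<gamma>"]) simp

lemma proof_consequence:
  assumes "d \<in> P" "consequence \<gamma> d \<gamma>s" "\<And>\<delta>. \<delta> \<in> set \<gamma>s \<Longrightarrow> is_proof P A \<delta> (f \<delta>)"
  shows "is_proof P A \<gamma> (Node \<gamma> d (map f \<gamma>s))"
proof -
  have "map root (map f \<gamma>s) = \<gamma>s"
    using assms(3) by (simp add: is_proof_def map_idI)
  then show ?thesis
    using assms unfolding is_proof_def by (simp del: map_map)
qed

lemma provable_consequence:
  assumes "d \<in> P" "consequence \<gamma> d \<gamma>s" "\<And>\<delta>. \<delta> \<in> set \<gamma>s \<Longrightarrow> provable P A \<delta>"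
  shows "provable P A \<gamma>"
  using proof_consequence[of d P \<gamma> \<gamma>s A "\<lambda>\<delta>. SOME t. is_proof P A \<delta> t"] assms
  unfolding provable_def by (metis someI_ex)

text \<open>The support collects the rules of all proofs, so any proof of one premise can be grafted
  below \<open>\<gamma>\<close> once the other premises are provable. Read backwards: if all proofs
  of \<open>\<gamma>\<close> stay within a set of rules, so do those of its premises.\<close>

lemma fact_support_consequence:
  assumes d: "d \<in> P" "consequence \<gamma> d \<gamma>s" and prov: "\<And>\<delta>. \<delta> \<in> set \<gamma>s \<Longrightarrow> provable P A \<delta>"
  shows "d \<in> fact_support P A \<gamma>"
    and "\<delta> \<in> set \<gamma>s \<Longrightarrow> fact_support P A \<delta> \<subseteq> fact_support P A \<gamma>"
proof -
  obtain f where f: "\<And>\<delta>. \<delta> \<in> set \<gamma>s \<Longrightarrow> is_proof P A \<delta> (f \<delta>)"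
    using prov unfolding provable_def by metis
  have "is_proof P A \<gamma> (Node \<gamma> d (map f \<gamma>s))"
    using proof_consequence[OF d f] .
  then show "d \<in> fact_support P A \<gamma>"
    unfolding fact_support_def by fastforce
  assume \<delta>: "\<delta> \<in> set \<gamma>s"
  have "tree_rules t \<subseteq> fact_support P A \<gamma>" if t: "is_proof P A \<delta> t" for t
  proof -
    have "is_proof P A \<gamma> (Node \<gamma> d (map (f(\<delta> := t)) \<gamma>s))"
      by (rule proof_consequence[OF d]) (simp add: f t)
    moreover have "tree_rules t \<subseteq> tree_rules (Node \<gamma> d (map (f(\<delta> := t)) \<gamma>s))"
      using \<delta> by auto
    ultimately show ?thesis
      unfolding fact_support_def by blast
  qed
  then show "fact_support P A \<delta> \<subseteq> fact_support P A \<gamma>"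
    unfolding fact_support_def by blast
qed

section \<open>Coding labelled elements\<close>

text \<open>\<open>entails\<close> fixes the type of domain elements, so pairs of an element and a
  label have to be coded in \<open>'d\<close> again. For finite nonempty \<open>L\<close> the
  product has the cardinality of \<open>'d\<close>.\<close>

lemma ex_inj_on_Times_finite:
  assumes "finite L"
  shows "\<exists>e :: 'd::infinite \<times> 'l \<Rightarrow> 'd. inj_on e (UNIV \<times> L)"
proof (cases "L = {}")
  case False
  have inf: "infinite (UNIV :: 'd set)" by (rule infinite_UNIV)
  \<comment> \<open>The opposite comparison would make \<open>L\<close> infinite.\<close>
  then have "(card_of L, card_of (UNIV :: 'd set)) \<in> ordLeq"
    using card_of_ordLeq_infinite[of "UNIV :: 'd set" L] assms
      ordLeq_total[OF card_of_Well_order[of L] card_of_Well_order[of "UNIV :: 'd set"]] by blast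
  then have "(card_of ((UNIV :: 'd set) \<times> L), card_of (UNIV :: 'd set)) \<in> ordIso"
    using card_of_Times_infinite[OF inf False] by blast
  then have "(card_of ((UNIV :: 'd set) \<times> L), card_of (UNIV :: 'd set)) \<in> ordLeq"
    by (rule ordIso_imp_ordLeq)
  then show ?thesis
    using card_of_ordLeq[of "(UNIV :: 'd set) \<times> L" "UNIV :: 'd set"] by blast
qed simp

section \<open>Datalog rules obtained from head atoms\<close>

lemma ground_skolem:
  assumes "set (exs r) \<subseteq> dom \<theta>"
  shows "ground l (subst_atom (skolem \<theta> r) a)
    = ground (\<lambda>x. if x \<in> set (exs r) then the (\<theta> x) else l x) a"
proof -
  have "case_trm l id (subst_trm (skolem \<theta> r) t)
      = case_trm (\<lambda>x. if x \<in> set (exs r) then the (\<theta> x) else l x) id t" for t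
    using assms by (cases t) (auto simp: skolem_def split: option.splits)
  then show ?thesis
    by (cases a) (simp add: ground_def subst_atom_def)
qed

text \<open>\<open>skolem\<close> replaces the existential variables of the head atom by constants,
  so by safety only body variables remain in it.\<close>

lemma consequence_skolem:
  assumes "wf_rule r" "set (exs r) \<subseteq> dom \<theta>" "a \<in> head_atoms r"
  shows "consequence (ground (\<lambda>x. if x \<in> set (exs r) then the (\<theta> x) else l x) a)
    (DRule (body r) (subst_atom (skolem \<theta> r) a)) (map (ground l) (body r))"
proof -
  have "y \<in> atom_vars a - set (exs r)" if y: "y \<in> atom_vars (subst_atom (skolem \<theta> r) a)" for y
  proof -
    obtain t where t: "t \<in> set (args a)" "Var y = subst_trm (skolem \<theta> r) t"
      using y by (cases a) (auto simp: atom_vars_def subst_atom_def)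
    from t(2) obtain z where "t = Var z" "skolem \<theta> r z = Var y"
      by (cases t) auto
    moreover from this have "z = y" "y \<notin> set (exs r)"
      using assms(2) by (auto simp: skolem_def split: if_splits option.splits)
    ultimately show ?thesis
      using t(1) by (simp add: atom_vars_def)
  qed
  then have "atom_vars (subst_atom (skolem \<theta> r) a) \<subseteq> (\<Union>b\<in>set (body r). atom_vars b)"
    using assms(1,3) by (fastforce simp: wf_rule_def safe_def body_atoms_def)
  from consequence_ground[OF this] show ?thesis
    by (simp add: ground_skolem[OF assms(2)])
qed

section \<open>The model on labelled elements\<close>

text \<open>Agreement on facts is needed both ways: from \<open>I\<close> to \<open>J\<close> for
  the ABox, from \<open>J\<close> to \<open>I\<close> for \<open>\<gamma>\<close>.\<close>

lemma module_model_extends: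
  fixes T :: "('p, 'v, 'c) rule set" and I :: "('p, 'c, 'd::infinite) interp"
  assumes T: "tbox T" "tbox_constants T = {}" and \<Sigma>: "Bot \<in> \<Sigma>"
    and I: "is_interp I" "\<And>r. r \<in> setting_module T (fact_setting T \<Sigma> c star) \<Longrightarrow> sat_rule I r"
  obtains J :: "('p, 'c, 'd) interp" where "is_interp J" "\<And>r. r \<in> T \<Longrightarrow> sat_rule J r"
    "\<And>\<alpha>. fact_over \<Sigma> \<alpha> \<Longrightarrow> sat_fact J \<alpha> \<longleftrightarrow> sat_fact I \<alpha>"
proof -
  define \<chi> where "\<chi> = fact_setting T \<Sigma> c star"
  define P where "P = setting_program T \<chi>"
  define S where "S = setting_support T \<chi>"
  \<comment> \<open>This is vacuous for unprovable facts, whose support is empty; hence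
    \<open>J\<close> demands provability separately.\<close>
  define supported where "supported \<alpha> \<longleftrightarrow> fact_support P (abox0 \<chi>) \<alpha> \<subseteq> S" for \<alpha>
  define L where "L = insert star (c ` tbox_exs T)"
  have "finite L"
    using T(1) by (auto simp: L_def tbox_def tbox_exs_def)
  then obtain e :: "'d \<times> 'c \<Rightarrow> 'd" where e: "inj_on e (UNIV \<times> L)"
    using ex_inj_on_Times_finite by blast
  define el where "el x = fst (inv_into (UNIV \<times> L) e x)" for x
  define lab where "lab x = snd (inv_into (UNIV \<times> L) e x)" for x
  have [simp]: "el (e (d, k)) = d" "lab (e (d, k)) = k" if "k \<in> L" for d k
    using that e by (auto simp: el_def lab_def)
  define J :: "('p, 'c, 'd) interp" where
    "J = \<lparr>dom_of = e ` (dom_of I \<times> L), const_int = (\<lambda>k. e (const_int I k, star)),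
          pred_int = (\<lambda>Q. {ds. set ds \<subseteq> e ` (dom_of I \<times> L) \<and> length ds = arity Q \<and>
            provable P (abox0 \<chi>) (Atom Q (map lab ds)) \<and>
            (supported (Atom Q (map lab ds)) \<longrightarrow> map el ds \<in> pred_int I Q)})\<rparr>"
  have star: "star \<in> L" by (simp add: L_def)
  have sat_atom_J: "sat_atom J v a \<longleftrightarrow> provable P (abox0 \<chi>) (ground (lab \<circ> v) a) \<and>
      (supported (ground (lab \<circ> v) a) \<longrightarrow> sat_atom I (el \<circ> v) a)"
    if v: "range v \<subseteq> dom_of J" and a: "r \<in> T" "a \<in> body_atoms r \<union> head_atoms r" for v a r
  proof -
    \<comment> \<open>A constant would be kept by \<open>ground\<close> but carry the label
      \<open>star\<close> in \<open>J\<close>; in \<open>T\<close> all arguments are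
      variables.\<close>
    have "atom_constants a = {}" and wf: "wf_atom a"
      using a T by (fastforce simp: tbox_constants_def tbox_def wf_rule_def)+
    then have var: "\<exists>x. t = Var x" if "t \<in> set (args a)" for t
      using that by (cases t) (auto simp: atom_constants_def)
    have "map lab (map (trm_val J v) (args a)) = args (ground (lab \<circ> v) a)"
      using var by (fastforce simp: args_ground)
    moreover have "map el (map (trm_val J v) (args a)) = map (trm_val I (el \<circ> v)) (args a)"
      using var by fastforce
    moreover have "set (map (trm_val J v) (args a)) \<subseteq> e ` (dom_of I \<times> L)"
      using var v by (fastforce simp: J_def)
    moreover have "Atom (pred_of a) (args (ground (lab \<circ> v) a)) = ground (lab \<circ> v) a"
      by (metis atom.collapse pred_of_ground)
    moreover have "length (args a) = arity (pred_of a)"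
      using wf by (simp add: wf_atom_def)
    ultimately show ?thesis
      by (simp add: sat_atom_def J_def del: map_map)
  qed
  have abox: "provable P (abox0 \<chi>) \<alpha>" "supported \<alpha>" if "\<alpha> \<in> abox0 \<chi>" for \<alpha>
  proof -
    show "provable P (abox0 \<chi>) \<alpha>"
      using that by (rule provable_fact)
    \<comment> \<open>Initial and relevant facts coincide, so all proofs of an initial fact
      contribute to \<open>S\<close>.\<close>
    have "\<alpha> \<in> aboxr \<chi>" using that by (simp add: \<chi>_def fact_setting_def)
    then show "supported \<alpha>"
      unfolding supported_def S_def setting_support_def P_def by blast
  qed
  have Bot0: "Atom Bot [] \<in> abox0 \<chi>"
    using \<Sigma> by (force simp: \<chi>_def fact_setting_def)
  have "is_interp J"
  proof -
    \<comment> \<open>The fact of \<open>Bot\<close> is supported, so \<open>J\<close> refers to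
      \<open>I\<close>, where \<open>Bot\<close> is empty.\<close>
    have "pred_int J Bot = {}"
      using I(1) abox[OF Bot0] by (auto simp: J_def is_interp_def)
    moreover have "dom_of J \<noteq> {}" "range (const_int J) \<subseteq> dom_of J"
      using I(1) star by (auto simp: J_def is_interp_def)
    ultimately show ?thesis
      by (auto simp: is_interp_def J_def)
  qed
  moreover have "sat_fact J \<alpha> \<longleftrightarrow> sat_fact I \<alpha>" if \<alpha>: "fact_over \<Sigma> \<alpha>" for \<alpha>
  proof -
    have len: "length (args \<alpha>) = arity (pred_of \<alpha>)" and "pred_of \<alpha> \<in> \<Sigma>"
      using \<alpha> by (auto simp: fact_over_def wf_atom_def)
    \<comment> \<open>Constants are labelled \<open>star\<close> in \<open>J\<close>, so the labels
      of \<open>\<alpha>\<close> form this initial fact.\<close>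
    then have "Atom (pred_of \<alpha>) (replicate (arity (pred_of \<alpha>)) star) \<in> abox0 \<chi>"
      by (auto simp: \<chi>_def fact_setting_def)
    note abox[OF this]
    moreover have "set (map (const_int J) (args \<alpha>)) \<subseteq> e ` (dom_of I \<times> L)"
      using I(1) star by (auto simp: J_def is_interp_def image_subset_iff intro!: imageI)
    moreover have "map lab (map (const_int J) (args \<alpha>)) = replicate (arity (pred_of \<alpha>)) star"
      using star len by (simp add: J_def comp_def map_replicate_const)
    moreover have "map el (map (const_int J) (args \<alpha>)) = map (const_int I) (args \<alpha>)"
      using star by (simp add: J_def)
    ultimately show ?thesis
      using len by (simp add: sat_fact_def J_def del: map_map)
  qed
  moreover have "sat_rule J r" if r: "r \<in> T" for r
  proof -
    have wf: "wf_rule r" using r T(1) by (simp add: tbox_def)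
    have theta: "theta \<chi> y = Some (c y)" and c_L: "c y \<in> L" if "y \<in> set (exs r)" for y
      using r that by (auto simp: \<chi>_def fact_setting_def tbox_exs_def L_def)
    then have exs: "set (exs r) \<subseteq> dom (theta \<chi>)" by blast
    have rules: "datalog_rules (theta \<chi>) r \<subseteq> P"
      using r by (auto simp: P_def setting_program_def)
    have "\<exists>w. range w \<subseteq> dom_of J \<and> (\<forall>x. x \<notin> set (exs r) \<longrightarrow> w x = v x) \<and>
        (\<exists>\<psi>\<in>set (heads r). \<forall>a\<in>set \<psi>. sat_atom J w a)"
      if v: "range v \<subseteq> dom_of J" and body: "\<forall>a\<in>set (body r). sat_atom J v a" for v
    proof -
      have v_dom: "el (v x) \<in> dom_of I \<and> lab (v x) \<in> L \<and> e (el (v x), lab (v x)) = v x" for x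
      proof -
        have "v x \<in> e ` (dom_of I \<times> L)"
          using v by (auto simp: J_def)
        then show ?thesis by auto
      qed
      then have v_I: "range (el \<circ> v) \<subseteq> dom_of I" by auto
      define l where "l x = (if x \<in> set (exs r) then c x else lab (v x))" for x
      have l_L: "l x \<in> L" for x
        by (simp add: l_def c_L v_dom)
      have body': "provable P (abox0 \<chi>) (ground (lab \<circ> v) b)"
        "supported (ground (lab \<circ> v) b) \<Longrightarrow> sat_atom I (el \<circ> v) b" if "b \<in> set (body r)" for b
        using that body sat_atom_J[OF v r, of b] by (auto simp: body_atoms_def)
      have body_prov: "provable P (abox0 \<chi>) \<delta>" if "\<delta> \<in> set (map (ground (lab \<circ> v)) (body r))" for \<delta>
        using that body'(1) by auto
      \<comment> \<open>A supported conclusion puts \<open>d\<close> into \<open>S\<close> and hence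
        \<open>r\<close> into the module; by grafting, the body facts are supported too, so the body
        holds in \<open>I\<close>.\<close>
      have in_module: "r \<in> setting_module T \<chi> \<and> (\<forall>b\<in>body_atoms r. sat_atom I (el \<circ> v) b)"
        if "supported \<delta>" "d \<in> datalog_rules (theta \<chi>) r"
          "consequence \<delta> d (map (ground (lab \<circ> v)) (body r))" for \<delta> d
      proof -
        have "d \<in> P" using that(2) rules by blast
        note supp = fact_support_consequence[OF this that(3) body_prov]
        have "d \<in> S"
          using supp(1) that(1) unfolding supported_def by blast
        moreover have "supported (ground (lab \<circ> v) b)" if "b \<in> set (body r)" for b
          using supp(2)[of "ground (lab \<circ> v) b"] \<open>supported \<delta>\<close> that
          unfolding supported_def by auto
        ultimately show ?thesis
          using r that(2) body'(2) unfolding setting_module_def S_def body_atoms_def by blast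
      qed
      have sat_I: "\<exists>u. range u \<subseteq> dom_of I \<and> (\<forall>x. x \<notin> set (exs r) \<longrightarrow> u x = (el \<circ> v) x) \<and>
          (\<exists>\<psi>\<in>set (heads r). \<forall>a\<in>set \<psi>. sat_atom I u a)"
        if "supported \<delta>" "d \<in> datalog_rules (theta \<chi>) r"
          "consequence \<delta> d (map (ground (lab \<circ> v)) (body r))" for \<delta> d
      proof -
        have "sat_rule I r" using in_module[OF that] I(2) by (simp add: \<chi>_def)
        moreover have "\<forall>a\<in>set (body r). sat_atom I (el \<circ> v) a"
          using in_module[OF that] by (simp add: body_atoms_def)
        ultimately show ?thesis
          using v_I unfolding sat_rule_def by blast
      qed
      \<comment> \<open>Otherwise \<open>r\<close> derives the supported fact of \<open>Bot\<close>,
        and \<open>I\<close> would have to satisfy an empty disjunction.\<close>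
      have "heads r \<noteq> []"
      proof
        assume "heads r = []"
        then have d: "DRule (body r) (Atom Bot []) \<in> datalog_rules (theta \<chi>) r"
          by (simp add: datalog_rules_def)
        have "consequence (Atom Bot []) (DRule (body r) (Atom Bot [])) (map (ground (lab \<circ> v)) (body r))"
          using consequence_ground[of "Atom Bot []" "body r" "lab \<circ> v"]
          by (simp add: atom_vars_def ground_def)
        from sat_I[OF abox(2)[OF Bot0] d this] show False
          using \<open>heads r = []\<close> by auto
      qed
      then have drule: "DRule (body r) (subst_atom (skolem (theta \<chi>) r) a) \<in> datalog_rules (theta \<chi>) r"
        if "a \<in> head_atoms r" for a
        using that by (auto simp: datalog_rules_def)
      have head: "consequence (ground l a) (DRule (body r) (subst_atom (skolem (theta \<chi>) r) a))
          (map (ground (lab \<circ> v)) (body r))" if "a \<in> head_atoms r" for a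
      proof -
        have "(\<lambda>x. if x \<in> set (exs r) then the (theta \<chi> x) else (lab \<circ> v) x) = l"
          by (auto simp: l_def theta)
        then show ?thesis
          using consequence_skolem[OF wf exs that, of "lab \<circ> v"] by simp
      qed
      have head_prov: "provable P (abox0 \<chi>) (ground l a)" if "a \<in> head_atoms r" for a
        using provable_consequence[OF _ head[OF that] body_prov] drule[OF that] rules by blast
      obtain u \<psi> where u: "range u \<subseteq> dom_of I" "\<And>x. x \<notin> set (exs r) \<Longrightarrow> u x = el (v x)"
        and \<psi>: "\<psi> \<in> set (heads r)" "\<And>a. a \<in> set \<psi> \<Longrightarrow> supported (ground l a) \<Longrightarrow> sat_atom I u a"
      proof (cases "\<exists>a\<in>head_atoms r. supported (ground l a)")
        case True
        then obtain a where a: "a \<in> head_atoms r" "supported (ground l a)" by blast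
        from sat_I[OF a(2) drule[OF a(1)] head[OF a(1)]] show thesis
          using that by auto
      next
        case False
        \<comment> \<open>No head atom refers to \<open>I\<close> here, so any disjunct serves, and
          \<open>u\<close> may be \<open>el \<circ> v\<close>.\<close>
        have "hd (heads r) \<in> set (heads r)" using \<open>heads r \<noteq> []\<close> by simp
        moreover have "\<not> supported (ground l a)" if "a \<in> set (hd (heads r))" for a
          using False that calculation unfolding head_atoms_def by blast
        ultimately show thesis
          using that[of "el \<circ> v" "hd (heads r)"] v_I by auto
      qed
      \<comment> \<open>Existential variables get their witness from \<open>I\<close> paired with
        the label \<open>c x\<close>; on all others \<open>w\<close> recovers
        \<open>v\<close>.\<close>
      define w where "w x = e (u x, l x)" for x
      have w: "range w \<subseteq> dom_of J" "lab \<circ> w = l" "el \<circ> w = u"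
        using u(1) l_L by (auto simp: w_def J_def)
      have "w x = v x" if "x \<notin> set (exs r)" for x
        using that u(2) v_dom by (simp add: w_def l_def)
      moreover have "sat_atom J w a" if "a \<in> set \<psi>" for a
      proof -
        have "a \<in> head_atoms r"
          using that \<psi>(1) by (auto simp: head_atoms_def)
        then show ?thesis
          using sat_atom_J[OF w(1) r, of a] head_prov \<psi>(2)[OF that] by (simp add: w(2,3))
      qed
      ultimately show ?thesis
        using w(1) \<psi>(1) by blast
    qed
    then show ?thesis
      unfolding sat_rule_def by blast
  qed
  ultimately show thesis
    using that by blast
qed

theorem theorem5:
  fixes T :: "('p, 'v, 'c) rule set"
    and \<Sigma> :: "'p predicate set"
    and c :: "'v \<Rightarrow> 'c"
    and star :: 'c
  assumes "tbox T"
    and "tbox_constants T = {}"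
    and "exs_apart T"
    and "signature \<Sigma>"
    and "\<Sigma> \<subseteq> tbox_sig T"
    and "fresh_constants T c star"
  shows "fact_inseparable TYPE('d::infinite) \<Sigma> (setting_module T (fact_setting T \<Sigma> c star)) T"
  unfolding fact_inseparable_def
proof (intro allI impI iffI)
  let ?M = "setting_module T (fact_setting T \<Sigma> c star)"
  fix \<gamma> :: "('p, 'c) fact" and A :: "('p, 'c) fact set"
  assume \<Sigma>: "fact_over \<Sigma> \<gamma> \<and> abox_over \<Sigma> A"
  have "?M \<subseteq> T" by (auto simp: setting_module_def)
  then show "entails TYPE('d) T A \<gamma>" if "entails TYPE('d) ?M A \<gamma>"
    using that unfolding entails_def by blast
  show "entails TYPE('d) ?M A \<gamma>" if ent: "entails TYPE('d) T A \<gamma>"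
    unfolding entails_def
  proof (intro allI impI)
    fix I :: "('p, 'c, 'd) interp"
    assume I: "is_interp I \<and> (\<forall>r\<in>?M. sat_rule I r) \<and> (\<forall>\<alpha>\<in>A. sat_fact I \<alpha>)"
    have "Bot \<in> \<Sigma>" using assms(4) by (simp add: signature_def)
    then obtain J :: "('p, 'c, 'd) interp" where J: "is_interp J" "\<And>r. r \<in> T \<Longrightarrow> sat_rule J r"
      "\<And>\<alpha>. fact_over \<Sigma> \<alpha> \<Longrightarrow> sat_fact J \<alpha> \<longleftrightarrow> sat_fact I \<alpha>"
      using module_model_extends[OF assms(1,2), of \<Sigma> I c star] I by blast
    then have "\<forall>\<alpha>\<in>A. sat_fact J \<alpha>"
      using I \<Sigma> by (simp add: abox_over_def)
    then have "sat_fact J \<gamma>"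
      using ent J(1,2) unfolding entails_def by blast
    then show "sat_fact I \<gamma>"
      using J(3) \<Sigma> by blast
  qed
qed

end
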